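(* Let $\mu\in\mathbb{C}$ with $\mu\neq-1,-2,-3,\ldots$ and let $\ell\in\mathbb{N}_0$. For every $j\in\mathbb{N}_0$ the polynomial $M_j^{\mu,\ell}(x)$ is a solution on $\mathbb{R}_+$ of the fourth order differential equation $$\mathcal{P}_{\mu,\ell}u=j(j+\mu+1)u.$$ Moreover, if $\mu$ is real with $\mu\geq2\ell+1$, then, up to scalar multiples, $M_j^{\mu,\ell}$ is the unique polynomial solution of this equation.
   Context: Let $I_\alpha$, $K_\alpha$ be the modified Bessel functions and set $\widetilde I_\alpha(z)=(z/2)^{-\alpha}I_\alpha(z)$, $\widetilde K_\alpha(z)=(z/2)^{-\alpha}K_\alpha(z)$. For $\mu\in\mathbb{C}$, $\ell\in\mathbb{N}_0$, $x>0$ and $t$ near $0$ define $$G^{\mu,\ell}(t,x)=\frac{1}{(1-t)^{\ell+\frac{\mu+3}{2}}}\left(\frac x2\right)^{2\ell+1}e^{\frac x2}\,\widetilde I_{\frac\mu2}\!\left(\frac{tx}{2(1-t)}\right)\widetilde K_{\ell+\frac12}\!\left(\frac{x}{2(1-t)}\right),$$ and $M_j^{\mu,\ell}(x)=\frac{\Gamma(j+\mu+1)}{j!\,2^\mu\,\Gamma(j+\frac{\mu+1}{2})}\left.\frac{\partial^j}{\partial t^j}\right|_{t=0}G^{\mu,\ell}(t,x)$ (a polynomial in $x$). Let $\theta=x\frac{d}{dx}$ be the Euler operator and define the operator on $\mathbb{R}_+$ $$\mathcal{P}_{\mu,\ell}=\frac{1}{x^2}\Big(\big(\theta+\mu-2\ell-1-\tfrac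 x2\big)\big(\theta+\mu-\tfrac x2\big)-\big(\tfrac x2\big)^2\Big)\Big(\big(\theta-2\ell-1-\tfrac x2\big)\big(\theta-\tfrac x2\big)-\big(\tfrac x2\big)^2\Big),$$ where products denote composition of operators and $x/2$, $(x/2)^2$ act by multiplication. *)

theory Defs
  imports "HOL-Analysis.Analysis" "HOL-Computational_Algebra.Polynomial"
begin

text \<open>Normalised modified Bessel function of the first kind:
  tI a z = (z/2)^(-a) I_a(z) = sum_k (z/2)^(2k) / (k! Gamma(k+a+1)), an entire function of z.\<close>
definition besselI_tilde :: "complex \<Rightarrow> complex \<Rightarrow> complex" where
  "besselI_tilde a z = (\<Sum>k. (z/2)^(2*k) * rGamma (of_nat k + a + 1) / of_nat (fact k))"

definition besselI :: "complex \<Rightarrow> complex \<Rightarrow> complex" where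
  "besselI a z = (z/2) powr a * besselI_tilde a z"

text \<open>Modified Bessel function of the second kind, for non-integer order a:
  K_a = (pi/2) (I_{-a} - I_a) / sin(a pi).  (Only used for half-integer orders.)\<close>
definition besselK :: "complex \<Rightarrow> complex \<Rightarrow> complex" where
  "besselK a z = (of_real pi / 2) * (besselI (-a) z - besselI a z) / sin (a * of_real pi)"

definition besselK_tilde :: "complex \<Rightarrow> complex \<Rightarrow> complex" where
  "besselK_tilde a z = (z/2) powr (-a) * besselK a z"

definition genG :: "complex \<Rightarrow> nat \<Rightarrow> complex \<Rightarrow> real \<Rightarrow> complex" where
  "genG \<mu> l t x =
     (1 - t) powr (-(of_nat l + (\<mu> + 3) / 2))
     * (of_real x / 2) ^ (2*l + 1) * exp (of_real x / 2)
     * besselI_tilde (\<mu> / 2) (t * of_real x / (2 * (1 - t)))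
     * besselK_tilde (of_nat l + 1/2) (of_real x / (2 * (1 - t)))"

definition polyM :: "complex \<Rightarrow> nat \<Rightarrow> nat \<Rightarrow> real \<Rightarrow> complex" where
  "polyM \<mu> l j x =
     Gamma (of_nat j + \<mu> + 1)
       / (of_nat (fact j) * 2 powr \<mu> * Gamma (of_nat j + (\<mu> + 1) / 2))
     * (deriv ^^ j) (\<lambda>t. genG \<mu> l t x) 0"

definition eulerOp :: "(real \<Rightarrow> complex) \<Rightarrow> real \<Rightarrow> complex" where
  "eulerOp u x = of_real x * vector_derivative u (at x)"

definition shiftOp :: "complex \<Rightarrow> (real \<Rightarrow> complex) \<Rightarrow> real \<Rightarrow> complex" where
  "shiftOp c u x = eulerOp u x + (c - of_real x / 2) * u x"

definition quadOp :: "complex \<Rightarrow> complex \<Rightarrow> (real \<Rightarrow> complex) \<Rightarrow> real \<Rightarrow> complex" where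
  "quadOp a b u x = shiftOp a (shiftOp b u) x - (of_real x / 2)^2 * u x"

definition opP :: "complex \<Rightarrow> nat \<Rightarrow> (real \<Rightarrow> complex) \<Rightarrow> real \<Rightarrow> complex" where
  "opP \<mu> l u x =
     (1 / (of_real x)^2) *
       quadOp (\<mu> - 2 * of_nat l - 1) \<mu> (quadOp (- 2 * of_nat l - 1) 0 u) x"

end

theory Submission
  imports Defs "HOL-Complex_Analysis.Laurent_Convergence"
begin

unbundle no vec_syntax

text \<open>
  Half-integer Bessel functions are elementary, so near \<open>t = 0\<close> the generating function is
  \<open>\<surd>\<pi> (1-t)\<^bsup>l-b\<^esup> f (s) q (x/(1-t))\<close> with \<open>b = (\<mu>+1)/2\<close>, \<open>s = t x/(1-t)\<close>,
  \<open>f s = e\<^bsup>-s/2\<^esup> \<I>\<^bsub>\<mu>/2\<^esub> (s/2)\<close> a Kummer function and \<open>q\<close> a reverse Bessel polynomial. The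
  coefficients \<open>c\<^sub>n\<close> of \<open>f\<close> and \<open>d\<^sub>k\<close> of \<open>q\<close> satisfy two-term recurrences, and the coefficient of
  \<open>x\<^sup>m\<close> is \<open>(1-t)\<^bsup>l-b-m\<^esup> h\<^sub>m (t)\<close> with \<open>h\<^sub>m (t) = \<Sum>\<^sub>n c\<^sub>n d\<^bsub>m-n\<^esub> t\<^sup>n\<close>. Since
  \<open>x\<^sup>2 P\<^bsub>\<mu>,l\<^esub> x\<^sup>m = \<alpha>\<^sub>m x\<^sup>m + \<beta>\<^sub>m x\<^bsup>m+1\<^esup> + \<gamma>\<^sub>m x\<^bsup>m+2\<^esup>\<close>, the claim
  \<open>P\<^bsub>\<mu>,l\<^esub> G = (t\<partial>\<^sub>t)(t\<partial>\<^sub>t + \<mu> + 1) G\<close> becomes, after comparing powers of \<open>x\<close> and \<open>t\<close>, a linear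
  relation between six of the products \<open>c\<^sub>n d\<^sub>k\<close>, which lies in the ideal of the two recurrences.
  For uniqueness, \<open>\<gamma>\<^sub>d = j(j+\<mu>+1)\<close> forces a polynomial solution to have degree \<open>j + l\<close>.
\<close>

subsection \<open>The Euler-type operators on polynomials\<close>

lemma nat_cases2: obtains "n = (0::nat)" | "n = 1" | m where "n = Suc (Suc m)"
  by (metis One_nat_def not0_implies_Suc)

text \<open>The derivative at \<open>x\<close> depends only on values near \<open>x\<close>, and the
  positive half-line is open. This allows the polynomial form of \<open>polyM\<close>, established
  for positive arguments, to be substituted under the operators.\<close>

lemma shiftOp_cong:
  assumes "\<And>y. y > 0 \<Longrightarrow> u y = v y" and "x > 0"
  shows "shiftOp c u x = shiftOp c v x"
proof -
  have ev: "eventually (\<lambda>y. y > 0 \<and> u y = v y) (nhds x)"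
    using eventually_nhds_in_open[of "{0<..}" x] assms by (auto elim!: eventually_mono)
  have "vector_derivative u (at x) = vector_derivative v (at x)"
    by (rule vector_derivative_cong_eq) (use ev assms in \<open>auto elim: eventually_mono\<close>)
  then show ?thesis using assms by (simp add: shiftOp_def eulerOp_def)
qed

lemma quadOp_cong:
  assumes "\<And>y. y > 0 \<Longrightarrow> u y = v y" and "x > 0"
  shows "quadOp a b u x = quadOp a b v x"
  using assms unfolding quadOp_def by (simp cong: shiftOp_cong)

lemma opP_cong:
  assumes "\<And>y. y > 0 \<Longrightarrow> u y = v y" and "x > 0"
  shows "opP \<mu> l u x = opP \<mu> l v x"
  using assms unfolding opP_def by (simp cong: quadOp_cong)

definition shift_poly :: "complex \<Rightarrow> complex poly \<Rightarrow> complex poly" where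
  "shift_poly c p = pCons 0 (pderiv p) + [:c, -1/2:] * p"

definition quad_poly :: "complex \<Rightarrow> complex \<Rightarrow> complex poly \<Rightarrow> complex poly" where
  "quad_poly a b p = shift_poly a (shift_poly b p) - [:0, 0, 1/4:] * p"

lemma shiftOp_poly:
  "shiftOp c (\<lambda>y. poly p (of_real y)) = (\<lambda>x. poly (shift_poly c p) (of_real x))"
proof
  fix x :: real
  have "((\<lambda>y. poly p (of_real y)) has_vector_derivative poly (pderiv p) (of_real x)) (at x)"
    by (rule has_vector_derivative_real_field[OF poly_DERIV])
  then show "shiftOp c (\<lambda>y. poly p (of_real y)) x = poly (shift_poly c p) (of_real x)"
    by (simp add: shiftOp_def eulerOp_def shift_poly_def vector_derivative_at algebra_simps)
qed

lemma quadOp_poly: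
  "quadOp a b (\<lambda>y. poly p (of_real y)) = (\<lambda>x. poly (quad_poly a b p) (of_real x))"
  by (rule ext) (simp add: quadOp_def quad_poly_def shiftOp_poly power2_eq_square algebra_simps)

text \<open>The two factors \<open>-x/2\<close> compose to \<open>x^2/4\<close>, which cancels
  against the subtracted square, so degrees rise by at most one. \<open>coeff (pCons 0 p) k\<close>
  serves as the coefficient of index \<open>k-1\<close>, read as zero at
  \<open>k = 0\<close>.\<close>

lemma coeff_quad_poly:
  "coeff (quad_poly a b p) k = (of_nat k + a) * (of_nat k + b) * coeff p k
     - (of_nat k + (a + b - 1) / 2) * coeff (pCons 0 p) k"
proof -
  have *: "coeff (shift_poly c p) k = (of_nat k + c) * coeff p k - coeff (pCons 0 p) k / 2" for c p k
    by (cases k) (auto simp: shift_poly_def coeff_pderiv algebra_simps)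
  show ?thesis
    by (cases k rule: nat.exhaust; cases "k - 1")
       (auto simp: quad_poly_def * field_simps)
qed

text \<open>After multiplication by \<open>x^2\<close> both sides are polynomials, and polynomials
  agreeing at infinitely many points are equal. Two quadratic factors, each raising degrees by at
  most one, leave exactly three terms per coefficient.\<close>

lemma opP_poly_eq_iff:
  fixes l :: nat and \<mu> :: complex
  defines "\<alpha> \<equiv> \<lambda>k. of_nat k * (of_nat k - 2 * of_nat l - 1) * (of_nat k + \<mu>) * (of_nat k + \<mu> - 2 * of_nat l - 1)"
    and "\<beta> \<equiv> \<lambda>k. - (of_nat k - 1 - of_nat l) * (of_nat k + \<mu>) * (of_nat k + \<mu> - 1 - 2 * of_nat l)
              - (of_nat k - 1) * (of_nat k - 2 * of_nat l - 2) * (of_nat k + \<mu> - 1 - of_nat l)"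
    and "\<gamma> \<equiv> \<lambda>k. (of_nat k - 2 - of_nat l) * (of_nat k - 1 + \<mu> - of_nat l)"
  shows "(\<forall>x::real>0. opP \<mu> l (\<lambda>y. poly p (of_real y)) x = e * poly p (of_real x)) \<longleftrightarrow>
    (\<forall>k. \<alpha> k * coeff p k + \<beta> k * coeff (pCons 0 p) k + \<gamma> k * coeff (pCons 0 (pCons 0 p)) k
        = e * coeff (pCons 0 (pCons 0 p)) k)"
proof -
  define q where "q = quad_poly (\<mu> - 2 * of_nat l - 1) \<mu> (quad_poly (- 2 * of_nat l - 1) 0 p)"
  have coeff_q: "coeff q k = \<alpha> k * coeff p k + \<beta> k * coeff (pCons 0 p) k + \<gamma> k * coeff (pCons 0 (pCons 0 p)) k" for k
  proof (cases k rule: nat_cases2)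
    case 1 then show ?thesis by (simp add: q_def coeff_quad_poly \<alpha>_def)
  next
    case 2 then show ?thesis by (simp add: q_def coeff_quad_poly \<alpha>_def \<beta>_def field_simps)
  next
    case (3 m) then show ?thesis by (simp add: q_def coeff_quad_poly \<alpha>_def \<beta>_def \<gamma>_def field_simps)
  qed
  have "opP \<mu> l (\<lambda>y. poly p (of_real y)) x = poly q (of_real x) / (of_real x)\<^sup>2" for x
    by (simp add: opP_def quadOp_poly q_def)
  then have "(\<forall>x::real>0. opP \<mu> l (\<lambda>y. poly p (of_real y)) x = e * poly p (of_real x)) \<longleftrightarrow>
      (\<forall>x::real>0. poly q (of_real x) = poly (smult e (pCons 0 (pCons 0 p))) (of_real x))"
    by (auto simp: field_simps power2_eq_square)
  also have "\<dots> \<longleftrightarrow> q = smult e (pCons 0 (pCons 0 p))"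
  proof
    assume *: "\<forall>x::real>0. poly q (of_real x) = poly (smult e (pCons 0 (pCons 0 p))) (of_real x)"
    show "q = smult e (pCons 0 (pCons 0 p))"
    proof (rule ccontr)
      assume "q \<noteq> smult e (pCons 0 (pCons 0 p))"
      then have "finite {z. poly (q - smult e (pCons 0 (pCons 0 p))) z = 0}"
        by (intro poly_roots_finite) simp
      moreover have "complex_of_real ` {0<..} \<subseteq> {z. poly (q - smult e (pCons 0 (pCons 0 p))) z = 0}"
        using * by auto
      ultimately have "finite (complex_of_real ` {0<..})" by (rule finite_subset[rotated])
      then show False by (simp add: finite_image_iff inj_on_def infinite_Ioi)
    qed
  qed auto
  also have "\<dots> \<longleftrightarrow> (\<forall>k. coeff q k = e * coeff (pCons 0 (pCons 0 p)) k)"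
    by (simp only: poly_eq_iff coeff_smult)
  finally show ?thesis by (simp only: coeff_q)
qed

text \<open>The coefficient form of the equation is linear in \<open>p\<close>, so scaling becomes
  pure algebra.\<close>

lemma opP_poly_smult:
  assumes "\<forall>x::real>0. opP \<mu> l (\<lambda>y. poly p (of_real y)) x = e * poly p (of_real x)"
  shows "\<forall>x::real>0. opP \<mu> l (\<lambda>y. poly (smult K p) (of_real y)) x = e * poly (smult K p) (of_real x)"
proof -
  have pc: "pCons 0 (smult K p) = smult K (pCons 0 p)" for p :: "complex poly" by simp
  have lin: "A * (K * p0) + B * (K * p1) + G * (K * p2) = e * (K * p2)"
    if "A * p0 + B * p1 + G * p2 = e * p2" for A B G p0 p1 p2 :: complex
    using that by algebra
  show ?thesis
    unfolding opP_poly_eq_iff pc coeff_smult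
    using assms[unfolded opP_poly_eq_iff] by (blast intro: lin)
qed

text \<open>Subtracting the multiple of \<open>q\<close> that kills index \<open>j + l\<close>
  leaves a solution \<open>s\<close>; if \<open>s\<close> were nonzero, its leading coefficient
  would force its degree to be \<open>j + l\<close>.\<close>

lemma opP_poly_solution_unique:
  fixes r :: real and j l :: nat
  assumes "r \<ge> real l"
  assumes p: "\<forall>x::real>0. opP (of_real r) l (\<lambda>y. poly p (of_real y)) x
                = of_nat j * (of_nat j + of_real r + 1) * poly p (of_real x)"
    and q: "\<forall>x::real>0. opP (of_real r) l (\<lambda>y. poly q (of_real y)) x
                = of_nat j * (of_nat j + of_real r + 1) * poly q (of_real x)"
    and nz: "coeff q (j + l) \<noteq> 0"
  shows "\<exists>c. p = smult c q"
proof -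
  define c where "c = coeff p (j + l) / coeff q (j + l)"
  define s where "s = p - smult c q"
  have s0: "coeff s (j + l) = 0" using nz by (simp add: s_def c_def)
  have lin: "A * (p0 - c * q0) + B * (p1 - c * q1) + G * (p2 - c * q2) = e * (p2 - c * q2)"
    if "A * p0 + B * p1 + G * p2 = e * p2" "A * q0 + B * q1 + G * q2 = e * q2"
    for A B G e p0 p1 p2 q0 q1 q2 :: complex
    using that by algebra
  have coeff_s: "coeff s k = coeff p k - c * coeff q k"
      "coeff (pCons 0 s) k = coeff (pCons 0 p) k - c * coeff (pCons 0 q) k"
      "coeff (pCons 0 (pCons 0 s)) k = coeff (pCons 0 (pCons 0 p)) k - c * coeff (pCons 0 (pCons 0 q)) k" for k
    by (simp_all add: s_def coeff_pCons split: nat.split)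
  have S: "\<forall>x::real>0. opP (of_real r) l (\<lambda>y. poly s (of_real y)) x
                = of_nat j * (of_nat j + of_real r + 1) * poly s (of_real x)"
    unfolding opP_poly_eq_iff coeff_s
    using p[unfolded opP_poly_eq_iff] q[unfolded opP_poly_eq_iff] by (blast intro: lin)
  have "s = 0"
  proof (rule ccontr)
    assume "s \<noteq> 0"
    define d where "d = degree s"
    have d: "coeff s d \<noteq> 0" "coeff s (Suc d) = 0" "coeff s (Suc (Suc d)) = 0"
      using \<open>s \<noteq> 0\<close> by (auto simp: d_def coeff_eq_0)
    \<comment> \<open>At index \<open>d + 2\<close> only the \<gamma> term survives.\<close>
    have "(of_nat d - of_nat l) * (of_nat d + 1 + of_real r - of_nat l) = (of_nat j * (of_nat j + of_real r + 1) :: complex)"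
      using S[unfolded opP_poly_eq_iff, rule_format, of "Suc (Suc d)"] d
      by simp (simp add: algebra_simps)
    then have "complex_of_real ((real d - real l) * (real d + 1 + r - real l)) = of_real (real j * (real j + r + 1))"
      by simp
    then have "(real d - real l) * (real d + 1 + r - real l) = real j * (real j + r + 1)"
      by (simp only: of_real_eq_iff)
    \<comment> \<open>As a quadratic in \<open>d - l\<close> the relation has roots \<open>j\<close>
      and \<open>-(j + r + 1)\<close>; \<open>r \<ge> l\<close> excludes the second.\<close>
    then have "(real d - real l - real j) * (real d - real l + real j + r + 1) = 0"
      by (simp add: algebra_simps)
    moreover have "real d - real l + real j + r + 1 > 0" using assms(1) by linarith
    ultimately have "d = j + l" by simp
    then show False using d s0 by simp
  qed
  then show ?thesis by (auto simp: s_def)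
qed

subsection \<open>Bessel functions of half-integer order\<close>

text \<open>The series variable is \<open>(z/2)^2\<close> rather than \<open>z\<close>, so that
  differentiation merely raises \<open>a\<close> by one.\<close>

definition besselI_fps :: "complex \<Rightarrow> complex fps" where
  "besselI_fps a = Abs_fps (\<lambda>k. rGamma (of_nat k + a + 1) / fact k)"

lemma besselI_fps_nth: "besselI_fps a $ k = rGamma (of_nat k + a + 1) / fact k"
  by (simp add: besselI_fps_def)

lemma rGamma_shift: "rGamma (of_nat (Suc k) + a) * (of_nat k + a) = rGamma (of_nat k + a)"
  using rGamma_plus1[of "of_nat k + a"] by (simp add: algebra_simps)

lemma of_nat_Suc_times_divide_fact: "of_nat (Suc n) * (x / fact (Suc n)) = (x :: complex) / fact n"
  by (simp del: of_nat_Suc)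

text \<open>Consecutive coefficients differ by the factor \<open>(k+1)(k+a+1)\<close>. The relation
  is kept in multiplied form because \<open>rGamma\<close> may vanish.\<close>

lemma fps_conv_radius_besselI_fps [simp]: "fps_conv_radius (besselI_fps a) = \<infinity>"
  unfolding fps_conv_radius_def
proof (rule conv_radius_inftyI'')
  fix w :: complex
  \<comment> \<open>From \<open>N\<close> on, \<open>k+a+1\<close> has modulus at least
    \<open>2 * norm w + 1\<close>, which yields ratio \<open>1/2\<close>.\<close>
  define N where "N = nat \<lceil>norm a + 2 * norm w\<rceil>"
  show "summable (\<lambda>k. besselI_fps a $ k * w ^ k)"
  proof (rule summable_ratio_test[where c = "1/2" and N = N])
    fix k assume "k \<ge> N"
    then have k: "real k \<ge> norm a + 2 * norm w" by (simp add: N_def)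
    have "real k + 1 \<le> norm (of_nat (k + 1) + a) + norm a"
      using norm_triangle_ineq4[of "of_nat (k + 1) + a" a]
      by (metis add_diff_cancel_right' norm_of_nat of_nat_1 of_nat_add)
    then have big: "2 * norm w + 1 \<le> norm (of_nat k + a + 1)" using k by (simp add: algebra_simps)
    define A where "A = norm (besselI_fps a $ k * w ^ k)"
    define B where "B = norm (besselI_fps a $ Suc k * w ^ Suc k)"
    have e1: "of_nat (Suc k) * besselI_fps a $ Suc k = rGamma (of_nat (Suc k) + (a + 1)) / fact k"
      by (simp only: besselI_fps_nth of_nat_Suc_times_divide_fact add.assoc)
    have e2: "besselI_fps a $ k = (of_nat k + a + 1) * (of_nat (Suc k) * besselI_fps a $ Suc k)"
      unfolding e1 using rGamma_shift[of k "a + 1"] by (simp add: besselI_fps_nth field_simps)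
    have "besselI_fps a $ k * w ^ k * w = (of_nat k + a + 1) * of_nat (Suc k) * (besselI_fps a $ Suc k * w ^ Suc k)"
      unfolding e2 by (simp add: mult_ac)
    then have "norm (besselI_fps a $ k * w ^ k * w) = norm ((of_nat k + a + 1) * of_nat (Suc k) * (besselI_fps a $ Suc k * w ^ Suc k))"
      by (rule arg_cong)
    then have eq: "A * norm w = norm (of_nat k + a + 1) * real (Suc k) * B"
      unfolding norm_mult[of _ w] norm_mult[of "_ * of_nat (Suc k)"] norm_mult[of _ "of_nat (Suc k)"] A_def B_def
        norm_of_nat .
    have "(2 * norm w + 1) * 1 * B \<le> norm (of_nat k + a + 1) * real (Suc k) * B"
      by (intro mult_mono big) (auto simp: B_def)
    then have "(2 * norm w + 1) * B \<le> A * norm w" using eq by simp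
    \<comment> \<open>Enlarging \<open>norm w\<close> by \<open>1/2\<close> leaves a positive common
      factor to cancel even when \<open>w = 0\<close>.\<close>
    also have "\<dots> \<le> A * (norm w + 1/2)" by (intro mult_left_mono) (auto simp: A_def)
    finally have "(2 * norm w + 1) * B \<le> (2 * norm w + 1) * (1/2 * A)" by (simp add: algebra_simps)
    then have "B \<le> 1/2 * A" by (rule mult_left_le_imp_le) (simp add: add_nonneg_pos)
    then show "norm (besselI_fps a $ Suc k * w ^ Suc k) \<le> 1/2 * norm (besselI_fps a $ k * w ^ k)"
      by (simp only: A_def B_def)
  qed simp
qed

lemma fps_deriv_besselI_fps: "fps_deriv (besselI_fps a) = besselI_fps (a + 1)"
proof (rule fps_ext)
  fix n
  have "fps_deriv (besselI_fps a) $ n = of_nat (Suc n) * (rGamma (of_nat (Suc n) + a + 1) / fact (Suc n))"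
    by (simp add: besselI_fps_nth)
  then show "fps_deriv (besselI_fps a) $ n = besselI_fps (a + 1) $ n"
    unfolding of_nat_Suc_times_divide_fact by (simp add: besselI_fps_nth add_ac)
qed

text \<open>The classical recurrence \<open>I_a = (2(a+1)/z) I_(a+1) + I_(a+2)\<close> in normalised
  form. Together with the derivative rule it takes the place of Bessel's equation.\<close>

lemma besselI_fps_contiguous:
  "besselI_fps a = fps_const (a + 1) * besselI_fps (a + 1) + fps_X * besselI_fps (a + 2)"
proof (rule fps_ext)
  fix k
  show "besselI_fps a $ k = (fps_const (a + 1) * besselI_fps (a + 1) + fps_X * besselI_fps (a + 2)) $ k"
  proof (cases k)
    case 0
    then show ?thesis using rGamma_plus1[of "a + 1"] by (simp add: besselI_fps_nth add_ac)
  next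
    case (Suc m)
    have "rGamma (of_nat (Suc m) + a + 1) = (of_nat (Suc m) + a + 1) * rGamma (of_nat (Suc m) + a + 1 + 1)"
      by (rule rGamma_plus1[symmetric])
    moreover have "rGamma (of_nat m + (a + 2) + 1) / fact m
        = of_nat (Suc m) * (rGamma (of_nat m + (a + 2) + 1) / fact (Suc m))"
      by (rule of_nat_Suc_times_divide_fact[symmetric])
    ultimately show ?thesis using Suc by (simp add: besselI_fps_nth add_ac del: fact_Suc; simp add: algebra_simps add_divide_distrib del: fact_Suc)
  qed
qed

lemma besselI_tilde_eq_eval_fps: "besselI_tilde a z = eval_fps (besselI_fps a) ((z/2)\<^sup>2)"
  unfolding besselI_tilde_def eval_fps_def power_mult
  by (simp add: besselI_fps_nth mult.commute)

lemma besselI_tilde_0 [simp]: "besselI_tilde a 0 = rGamma (a + 1)"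
  by (simp add: besselI_tilde_eq_eval_fps eval_fps_at_0 besselI_fps_nth)

lemma besselI_tilde_contiguous:
  "besselI_tilde a z = (a + 1) * besselI_tilde (a + 1) z + (z/2)\<^sup>2 * besselI_tilde (a + 2) z"
proof -
  have r: "fps_conv_radius (f * besselI_fps c) = \<infinity>" if "fps_conv_radius f = \<infinity>" for f c
    using fps_conv_radius_mult[of f "besselI_fps c"] that by simp
  show ?thesis
    unfolding besselI_tilde_eq_eval_fps
    by (subst besselI_fps_contiguous, subst eval_fps_add) (simp_all add: r eval_fps_mult)
qed

lemma has_field_derivative_besselI_tilde:
  "(besselI_tilde a has_field_derivative z/2 * besselI_tilde (a + 1) z) (at z)"
proof -
  have "((\<lambda>z. eval_fps (besselI_fps a) ((z/2)\<^sup>2)) has_field_derivative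
           eval_fps (fps_deriv (besselI_fps a)) ((z/2)\<^sup>2) * (z/2)) (at z)"
    by (rule DERIV_chain2[OF has_field_derivative_eval_fps])
       (auto intro!: derivative_eq_intros simp: power2_eq_square)
  then show ?thesis
    by (simp add: besselI_tilde_eq_eval_fps[abs_def] fps_deriv_besselI_fps mult.commute)
qed

text \<open>This is \<open>(z/2)^(l+1/2) (I_(-l-1/2) - I_(l+1/2))\<close>, a constant multiple of
  \<open>(z/2)^(l+1/2) K_(l+1/2)\<close>, in a form free of fractional powers and entire in
  \<open>z\<close>.\<close>

definition besselV :: "nat \<Rightarrow> complex \<Rightarrow> complex" where
  "besselV l z = besselI_tilde (- of_nat l - 1/2) z
                 - (z/2) ^ (2*l + 1) * besselI_tilde (of_nat l + 1/2) z"

text \<open>With these coefficients, \<open>bessel_poly l\<close> at \<open>2z\<close> is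
  \<open>2^l\<close> times the reverse Bessel polynomial of degree \<open>l\<close> at
  \<open>z\<close>. The cut-off is explicit because truncated subtraction would give nonzero values
  beyond \<open>l\<close>.\<close>

definition bessel_coeff :: "nat \<Rightarrow> nat \<Rightarrow> complex" where
  "bessel_coeff l k = (if k \<le> l then fact (2*l - k) / (fact k * fact (l - k)) else 0)"

definition bessel_poly :: "nat \<Rightarrow> complex poly" where
  "bessel_poly l = (\<Sum>k\<le>l. monom (bessel_coeff l k) k)"

lemma coeff_bessel_poly: "coeff (bessel_poly l) k = bessel_coeff l k"
  by (auto simp: bessel_poly_def coeff_sum bessel_coeff_def)

text \<open>For \<open>k < l\<close> this is a ratio of factorials; from \<open>k = l\<close> on
  both sides vanish, so every index is covered.\<close>

lemma bessel_coeff_Suc: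
  "(of_nat k + 1) * (of_nat k - 2 * of_nat l) * bessel_coeff l (Suc k) = (of_nat k - of_nat l) * bessel_coeff l k"
proof (cases "Suc k \<le> l")
  case True
  then obtain m where "l = k + Suc m" by (metis Suc_le_eq less_iff_Suc_add add_Suc_right)
  then have l: "l - Suc k = m" "l - k = Suc m" "2*l - Suc k = k + 2*m + 1" "2*l - k = Suc (k + 2*m + 1)"
    by simp_all
  show ?thesis
    using \<open>l = k + Suc m\<close> True of_nat_neq_0[where 'a=complex, of k] of_nat_neq_0[where 'a=complex, of m]
    unfolding bessel_coeff_def l fact_Suc
    by (simp add: divide_simps del: fact_Suc) (simp add: algebra_simps)
next
  case False
  then show ?thesis by (cases "k = l") (auto simp: bessel_coeff_def)
qed

lemma bessel_coeff_Suc_Suc: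
  "2 * (of_nat k + 1) * bessel_coeff (Suc l) (Suc k) - bessel_coeff (Suc l) k
     = - (if k = 0 then 0 else bessel_coeff l (k - 1))"
proof -
  consider "k > Suc l" | "k = Suc l" | "k \<le> l" by linarith
  then show ?thesis
  proof cases
    case 3
    then obtain m where m: "l = k + m" using le_Suc_ex by blast
    then have l: "Suc l - Suc k = m" "Suc l - k = Suc m" "2 * Suc l - Suc k = k + 2*m + 1"
        "2 * Suc l - k = Suc (k + 2*m + 1)"
      by simp_all
    show ?thesis
    proof (cases k)
      case 0
      then show ?thesis using m of_nat_neq_0[where 'a=complex, of m]
        unfolding bessel_coeff_def l fact_Suc
        by (simp add: divide_simps del: fact_Suc)
    next
      case (Suc i)
      have l2: "2 * l - i = k + 2*m + 1" "l - i = Suc m" "k - 1 = i" using Suc m by simp_all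
      show ?thesis
        using Suc m of_nat_neq_0[where 'a=complex, of k] of_nat_neq_0[where 'a=complex, of m]
           of_nat_neq_0[where 'a=complex, of i]
        unfolding l2 bessel_coeff_def l fact_Suc
        by (simp add: l2 divide_simps del: of_nat_Suc) (simp add: algebra_simps)
    qed
  qed (use of_nat_neq_0[where 'a=complex, of l] in \<open>auto simp: bessel_coeff_def\<close>)
qed

text \<open>With \<open>q_l\<close> for \<open>bessel_poly l\<close>, this makes
  \<open>-2z e^(-z) q_l(2z)\<close> the derivative of \<open>e^(-z) q_(l+1)(2z)\<close>, which
  matches the derivative rule of \<open>besselV\<close>.\<close>

lemma bessel_poly_Suc:
  "smult 2 (pderiv (bessel_poly (Suc l))) - bessel_poly (Suc l) = - pCons 0 (bessel_poly l)"
proof (rule poly_eqI)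
  fix k
  show "coeff (smult 2 (pderiv (bessel_poly (Suc l))) - bessel_poly (Suc l)) k = coeff (- pCons 0 (bessel_poly l)) k"
    using bessel_coeff_Suc_Suc[of k l]
    by (auto simp: coeff_pderiv coeff_bessel_poly coeff_pCons algebra_simps split: nat.split)
qed

text \<open>The left side is the value of \<open>besselV l\<close> at 0, which fixes the constant of
  integration in \<open>besselV_eq\<close>.\<close>

lemma rGamma_half_minus_of_nat:
  "rGamma (1/2 - of_nat l) = (-1/4) ^ l / of_real (sqrt pi) * bessel_coeff l 0"
proof (induction l)
  case 0
  then show ?case by (simp add: rGamma_inverse_Gamma Gamma_one_half_complex bessel_coeff_def field_simps)
next
  case (Suc l)
  have "rGamma (1/2 - of_nat (Suc l)) = (1/2 - of_nat (Suc l)) * rGamma (1/2 - of_nat l :: complex)"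
    using rGamma_plus1[of "1/2 - of_nat (Suc l) :: complex"] by simp
  moreover have "bessel_coeff (Suc l) 0 = 2 * of_nat (2 * l + 1) * bessel_coeff l 0"
    using of_nat_neq_0[where 'a=complex, of l]
    by (simp add: bessel_coeff_def divide_simps) (simp add: algebra_simps)
  ultimately show ?case
    by (simp only: Suc.IH) (simp add: algebra_simps add_divide_distrib diff_divide_distrib)
qed

lemma has_field_derivative_besselV_Suc:
  "(besselV (Suc l) has_field_derivative z/2 * besselV l z) (at z)"
proof -
  \<comment> \<open>The product rule produces the orders \<open>l + 3/2\<close> and
    \<open>l + 5/2\<close>; this relation recombines them into order \<open>l + 1/2\<close>.\<close>
  have 1: "besselI_tilde (of_nat l + 1/2) z
     = (of_nat l + 3/2) * besselI_tilde (of_nat l + 3/2) z + (z/2)\<^sup>2 * besselI_tilde (of_nat l + 5/2) z"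
    using besselI_tilde_contiguous[of "of_nat l + 1/2" z] by (simp add: algebra_simps)
  have 2: "- of_nat (Suc l) - 1/2 + 1 = - of_nat l - (1/2 :: complex)"
     "of_nat (Suc l) + 1/2 = of_nat l + (3/2 :: complex)" "of_nat l + (3/2 :: complex) + 1 = of_nat l + 5/2"
    by simp_all
  have d1: "(besselI_tilde (- of_nat (Suc l) - 1/2) has_field_derivative
      z/2 * besselI_tilde (- of_nat l - 1/2) z) (at z)"
    using has_field_derivative_besselI_tilde[of "- of_nat (Suc l) - 1/2" z] unfolding 2 .
  have d2: "(besselI_tilde (of_nat (Suc l) + 1/2) has_field_derivative
      z/2 * besselI_tilde (of_nat l + 5/2) z) (at z)"
    using has_field_derivative_besselI_tilde[of "of_nat (Suc l) + 1/2" z] unfolding 2 .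
  have d3: "((\<lambda>z. (z/2) ^ (2 * Suc l + 1)) has_field_derivative (of_nat l + 3/2) * (z/2) ^ (2*l + 2)) (at z)"
    by (rule derivative_eq_intros refl | simp add: field_simps)+
  show ?thesis
    unfolding besselV_def[abs_def]
    by (rule DERIV_cong[OF DERIV_diff[OF d1 DERIV_mult[OF d3 d2]]], unfold 1 2)
       (simp add: field_simps power2_eq_square)
qed

text \<open>Induction on \<open>l\<close> by integration: both sides of the step have the same
  derivative and the same value at 0.\<close>

lemma besselV_eq: "besselV l z = (-1/4) ^ l / of_real (sqrt pi) * exp (-z) * poly (bessel_poly l) (2 * z)"
proof (induction l arbitrary: z)
  case 0
  have V0: "besselV 0 = (\<lambda>z. besselI_tilde (- (1/2)) z - z/2 * besselI_tilde (1/2) z)"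
    by (simp add: besselV_def fun_eq_iff)
  \<comment> \<open>The contiguous relation amounts to \<open>V' = -V\<close> for
    \<open>V = besselV 0\<close>.\<close>
  have "((\<lambda>z. exp z * besselV 0 z) has_field_derivative 0) (at z)" for z
  proof -
    have d1: "(besselI_tilde (- (1/2)) has_field_derivative z/2 * besselI_tilde (1/2) z) (at z)"
      using has_field_derivative_besselI_tilde[of "- (1/2)" z] by simp
    have d2: "(besselI_tilde (1/2) has_field_derivative z/2 * besselI_tilde (3/2) z) (at z)"
      using has_field_derivative_besselI_tilde[of "1/2" z] by simp
    have d3: "((\<lambda>z. z/2) has_field_derivative 1/2) (at z)"
      by (rule derivative_eq_intros refl | simp)+
    have 1: "besselI_tilde (- (1/2)) z = 1/2 * besselI_tilde (1/2) z + (z/2)\<^sup>2 * besselI_tilde (3/2) z"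
      using besselI_tilde_contiguous[of "- (1/2)" z] by simp
    show ?thesis unfolding V0
      by (rule DERIV_cong[OF DERIV_mult[OF DERIV_exp DERIV_diff[OF d1 DERIV_mult[OF d3 d2]]]], unfold 1)
         (simp add: algebra_simps power2_eq_square)
  qed
  then obtain c where c: "exp z * besselV 0 z = c" for z
    using has_field_derivative_zero_constant[of UNIV "\<lambda>z. exp z * besselV 0 z"] by auto
  have "c = 1 / of_real (sqrt pi)"
    using c[of 0] by (simp add: besselV_def rGamma_inverse_Gamma Gamma_one_half_complex field_simps)
  moreover have "besselV 0 z = exp (-z) * c" using c[of z] by (simp add: exp_minus field_simps)
  moreover have "bessel_poly 0 = 1" by (simp add: bessel_poly_def bessel_coeff_def)
  ultimately show ?case by simp
next
  case (Suc l)
  \<comment> \<open>The extra \<open>-1/4\<close> arises since \<open>c * (-2z)\<close> must equal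
    \<open>z/2\<close> times the constant for \<open>l\<close>.\<close>
  define c :: complex where "c = (-1/4) ^ Suc l / of_real (sqrt pi)"
  define D where "D = (\<lambda>z. besselV (Suc l) z - c * (exp (-z) * poly (bessel_poly (Suc l)) (2 * z)))"
  have P: "2 * poly (pderiv (bessel_poly (Suc l))) w - poly (bessel_poly (Suc l)) w = - w * poly (bessel_poly l) w" for w
    using arg_cong[OF bessel_poly_Suc[of l], of "\<lambda>p. poly p w"] by simp
  have "(D has_field_derivative z/2 * besselV l z - c * (exp (-z) *
     (2 * poly (pderiv (bessel_poly (Suc l))) (2 * z) - poly (bessel_poly (Suc l)) (2 * z)))) (at z)" for z
    unfolding D_def
    by (rule derivative_eq_intros has_field_derivative_besselV_Suc DERIV_chain2[OF poly_DERIV] refl | simp)+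
       (simp add: algebra_simps)
  then have "(D has_field_derivative 0) (at z)" for z
    unfolding P Suc by (simp add: c_def)
  then obtain k where k: "D z = k" for z
    using has_field_derivative_zero_constant[of UNIV D] by auto
  have "D 0 = 0"
    using rGamma_half_minus_of_nat[of "Suc l"]
    by (simp add: D_def c_def besselV_def poly_0_coeff_0 coeff_bessel_poly)
  then have "besselV (Suc l) z = c * (exp (-z) * poly (bessel_poly (Suc l)) (2 * z))"
    using k[of z] k[of 0] by (simp add: D_def)
  then show ?case by (simp only: c_def mult.assoc)
qed

subsection \<open>Power series in \<open>t\<close>\<close>

text \<open>The fractional powers either cancel or combine to the integer exponent
  \<open>-(2l+1)\<close>; as they share one base, the choice of branch does not matter.\<close>

lemma besselK_tilde_half_integer:
  assumes "z \<noteq> 0"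
  shows "besselK_tilde (of_nat l + 1/2) z = of_real pi / 2 * (-1) ^ l * besselV l z / (z/2) ^ (2*l + 1)"
proof -
  define a :: complex where "a = of_nat l + 1/2"
  define w where "w = z/2"
  have w: "w \<noteq> 0" using assms by (simp add: w_def)
  have sin: "sin (a * of_real pi) = (-1) ^ l"
  proof -
    have "a * of_real pi = of_real (pi/2 + real l * pi)" by (simp add: a_def algebra_simps)
    moreover have "sin (pi/2 + real l * pi) = (-1) ^ l" by (simp add: sin_add)
    ultimately show ?thesis by (metis of_real_1 of_real_minus of_real_power sin_of_real)
  qed
  have p1: "w powr (-a) * w powr a = 1" using w by (simp add: powr_minus)
  have "w powr (-a) * w powr (-a) = w powr (- of_nat (2*l + 1))"
  proof -
    have "-a + -a = - of_nat (2*l + 1)" by (simp add: a_def)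
    then show ?thesis by (metis powr_add)
  qed
  also have "\<dots> = 1 / w ^ (2*l + 1)" 
    using powr_nat'[of w "2*l + 1"] w by (metis powr_minus inverse_eq_divide)
  finally have p2: "w powr (-a) * w powr (-a) = 1 / w ^ (2*l + 1)" .
  have ma: "- of_nat l - 1/2 = -a" by (simp add: a_def)
  have sq: "y / (-1) ^ l = y * (-1) ^ l" for y :: complex by (cases "even l") auto
  have "besselK_tilde a z = of_real pi / 2 * (w powr (-a) * w powr (-a) * besselI_tilde (-a) z
          - w powr (-a) * w powr a * besselI_tilde a z) / (-1) ^ l"
    unfolding besselK_tilde_def besselK_def besselI_def sin w_def[symmetric] by (simp add: algebra_simps)
  also have "\<dots> = of_real pi / 2 * (-1) ^ l * (1 / w ^ (2*l + 1) * besselI_tilde (-a) z - besselI_tilde a z)"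
    unfolding p1 p2 sq by (simp only: right_diff_distrib left_diff_distrib mult_ac mult_1_left mult_1_right)
  also have "1 / w ^ (2*l + 1) * besselI_tilde (-a) z - besselI_tilde a z = besselV l z / w ^ (2*l + 1)"
    using w unfolding besselV_def ma w_def[symmetric] a_def[symmetric] by (simp add: field_simps)
  finally show ?thesis by (simp add: a_def w_def)
qed

text \<open>In terms of \<open>z = x/(2(1-t))\<close> the powers of \<open>z\<close> from the
  prefactor and from \<open>besselK_tilde\<close> cancel, and \<open>x/2 - z = -s/2\<close> merges
  the exponentials. What remains of the prefactor is a power of \<open>1 - t\<close>.\<close>

lemma genG_eq:
  fixes x :: real
  assumes "x > 0" "t \<noteq> 1"
  defines "s \<equiv> t * of_real x / (1 - t)"
  shows "genG \<mu> l t x = of_real (sqrt pi) * (1 - t) powr (of_nat l - (\<mu> + 1) / 2)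
           * (exp (- s / 2) * besselI_tilde (\<mu> / 2) (s / 2)) * poly (bessel_poly l) (of_real x / (1 - t))"
proof -
  define z where "z = of_real x / (2 * (1 - t))"
  define u where "u = 1 - t"
  have u: "u \<noteq> 0" using assms by (simp add: u_def)
  have z: "z \<noteq> 0" using assms u by (simp add: z_def)
  have x: "of_real x = 2 * z * u" using u by (simp add: z_def u_def field_simps)
  have s: "s / 2 = t * z" using u by (simp add: s_def z_def u_def field_simps)
  have "u powr (of_nat l - (\<mu> + 1) / 2) = u powr (-(of_nat l + (\<mu> + 3) / 2) + of_nat (2*l + 1))"
    by (rule arg_cong) (simp add: field_simps)
  then have p: "u powr (of_nat l - (\<mu> + 1) / 2) = u powr (-(of_nat l + (\<mu> + 3) / 2)) * u ^ (2*l + 1)"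
    using u powr_nat'[of u "2*l + 1"] by (metis powr_add)
  have e: "exp (of_real x / 2) * exp (-z) = exp (- s / 2)"
  proof -
    have "of_real x / 2 + (-z) = - s / 2" using s by (simp add: x u_def field_simps)
    then show ?thesis by (metis exp_add)
  qed
  have sp: "of_real pi = of_real (sqrt pi) * (of_real (sqrt pi) :: complex)"
    by (simp flip: of_real_mult)
  have sp0: "of_real (sqrt pi) \<noteq> (0 :: complex)" by simp
  have c: "of_real pi / 2 * (-1) ^ l * ((-1/4) ^ l / of_real (sqrt pi)) * 2 ^ (2*l + 1) = (of_real (sqrt pi) :: complex)"
  proof -
    have "(-1) ^ l * (-1/4) ^ l * 4 ^ l = (((-1) * (-1/4) * 4) ^ l :: complex)"
      unfolding power_mult_distrib ..
    then have "(-1) ^ l * (-1/4) ^ l * 4 ^ l = (1 :: complex)" by simp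
    moreover have "2 ^ (2*l + 1) = 2 * (4 ^ l :: complex)" by (simp add: power_mult)
    ultimately show ?thesis unfolding sp using sp0 by (simp add: mult_ac)
  qed
  define E :: complex where "E = exp (of_real x / 2)"
  define E' where "E' = exp (-z)"
  have "genG \<mu> l t x = u powr (-(of_nat l + (\<mu> + 3) / 2)) * (z * u) ^ (2*l + 1) * E
     * besselI_tilde (\<mu> / 2) (s / 2) * (of_real pi / 2 * (-1) ^ l * 
       ((-1/4) ^ l / of_real (sqrt pi) * E' * poly (bessel_poly l) (2 * z)) / (z/2) ^ (2*l + 1))"
  proof -
    have x2: "of_real x / 2 = z * u" by (simp add: x)
    have s2: "t * of_real x / (2 * u) = s / 2" and zu: "of_real x / (2 * u) = z"
      by (simp_all add: s_def u_def z_def)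
    show ?thesis
      unfolding genG_def u_def[symmetric] s2 zu besselK_tilde_half_integer[OF z] besselV_eq
        E_def[symmetric] E'_def[symmetric] unfolding x2 ..
  qed
  also have "(z * u) ^ (2*l + 1) = u ^ (2*l + 1) * 2 ^ (2*l + 1) * (z/2) ^ (2*l + 1)"
    by (simp add: power_mult_distrib power_divide)
  also have "u powr (-(of_nat l + (\<mu> + 3) / 2)) * (u ^ (2*l + 1) * 2 ^ (2*l + 1) * (z/2) ^ (2*l + 1)) * E
     * besselI_tilde (\<mu> / 2) (s / 2) * (of_real pi / 2 * (-1) ^ l * 
       ((-1/4) ^ l / of_real (sqrt pi) * E' * poly (bessel_poly l) (2 * z)) / (z/2) ^ (2*l + 1))
    = (of_real pi / 2 * (-1) ^ l * ((-1/4) ^ l / of_real (sqrt pi)) * 2 ^ (2*l + 1))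
      * (u powr (-(of_nat l + (\<mu> + 3) / 2)) * u ^ (2*l + 1)) * (E * E' * besselI_tilde (\<mu> / 2) (s / 2))
      * poly (bessel_poly l) (2 * z)"
    using z by (simp del: power_Suc)
  also have "\<dots> = of_real (sqrt pi) * u powr (of_nat l - (\<mu> + 1) / 2)
           * (exp (- s / 2) * besselI_tilde (\<mu> / 2) (s / 2)) * poly (bessel_poly l) (2 * z)"
    unfolding c p E_def E'_def e ..
  also have "2 * z = of_real x / (1 - t)" using u by (simp add: z_def u_def field_simps)
  finally show ?thesis by (simp only: u_def)
qed

section \<open>The Kummer factor and the expansion of the generating function\<close>

definition kummer_fps :: "complex \<Rightarrow> complex fps" where
  "kummer_fps \<mu> = fps_exp (-1/2) * (besselI_fps (\<mu> / 2) oo (fps_const (1/16) * fps_X\<^sup>2))"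

text \<open>The Bessel series has variable \<open>(z/2)^2\<close>; at \<open>z = s/2\<close> this is
  \<open>s^2/16\<close>, whence the inner series.\<close>

lemma kummer_has_fps_expansion:
  "(\<lambda>s. exp (- s / 2) * besselI_tilde (\<mu> / 2) (s / 2)) has_fps_expansion kummer_fps \<mu>"
proof -
  have "(eval_fps (besselI_fps (\<mu> / 2)) \<circ> (\<lambda>s. 1/16 * s\<^sup>2)) has_fps_expansion
          (besselI_fps (\<mu> / 2) oo (fps_const (1/16) * fps_X\<^sup>2))"
  proof (rule has_fps_expansion_compose)
    show "eval_fps (besselI_fps (\<mu> / 2)) has_fps_expansion besselI_fps (\<mu> / 2)"
      by (rule eval_fps_has_fps_expansion) simp
    show "(\<lambda>s. 1/16 * s\<^sup>2) has_fps_expansion (fps_const (1/16 :: complex) * fps_X\<^sup>2)"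
      by (intro fps_expansion_intros)
  qed (simp add: power2_eq_square)
  then have "(\<lambda>s. exp (-1/2 * s) * (eval_fps (besselI_fps (\<mu> / 2)) \<circ> (\<lambda>s. 1/16 * s\<^sup>2)) s) has_fps_expansion kummer_fps \<mu>"
    unfolding kummer_fps_def by (intro has_fps_expansion_mult has_fps_expansion_exp)
  moreover have "exp (-1/2 * s) * (eval_fps (besselI_fps (\<mu> / 2)) \<circ> (\<lambda>s. 1/16 * s\<^sup>2)) s
      = exp (- s / 2) * besselI_tilde (\<mu> / 2) (s / 2)" for s
    by (simp add: besselI_tilde_eq_eval_fps power2_eq_square)
  ultimately show ?thesis by simp
qed

lemma kummer_fps_nth_0: "kummer_fps \<mu> $ 0 = rGamma (\<mu> / 2 + 1)"
  by (simp add: kummer_fps_def besselI_fps_nth)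

text \<open>The series satisfies \<open>s f'' + (2b + s) f' + b f = 0\<close>, the equation of
  \<open>1F1(b; 2b; -s)\<close>; the recurrence is its coefficient at \<open>s^n\<close>.\<close>

lemma kummer_fps_nth_Suc:
  assumes "b = (\<mu> + 1) / 2"
  shows "(of_nat n + 1) * (of_nat n + 2*b) * kummer_fps \<mu> $ Suc n = - (of_nat n + b) * kummer_fps \<mu> $ n"
proof -
  define E where "E = fps_exp (-1/2 :: complex)"
  define u where "u = fps_const (1/16 :: complex) * fps_X\<^sup>2"
  define X where "X = (fps_X :: complex fps)"
  define a where "a = \<mu> / 2"
  define A where "A = fps_const a"
  define B where "B = fps_const b"
  define h where "h = fps_const (1/2 :: complex)"
  have b: "b = a + 1/2" using assms by (simp add: a_def field_simps)
  \<comment> \<open>All rational constants become powers of \<open>h\<close>, so the identities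
    below are polynomial modulo this one relation.\<close>
  have h: "2 * h = 1" by (simp add: h_def numeral_fps_const)
  have B: "B = A + h" by (simp add: B_def A_def h_def b)
  have u: "u = h ^ 4 * X\<^sup>2" by (simp add: u_def h_def X_def fps_const_power power_divide)
  have [simp]: "u $ 0 = 0" by (simp add: u_def)
  have [simp]: "fps_deriv X = 1" "fps_deriv h = 0" by (simp_all add: X_def h_def)
  have u': "fps_deriv u = h ^ 3 * X"
    unfolding u using h by (simp add: power2_eq_square fps_deriv_power) algebra
  \<comment> \<open>Differentiation raises \<open>i\<close> by one, and the contiguous relation
    expresses \<open>G 0\<close> by \<open>G 1\<close> and \<open>G 2\<close>; this closes the
    system.\<close>
  define G where "G = (\<lambda>i::nat. besselI_fps (a + of_nat i) oo u)"
  have G': "fps_deriv (G i) = G (Suc i) * (h ^ 3 * X)" for i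
    unfolding G_def by (subst fps_compose_deriv) (simp_all add: u' fps_deriv_besselI_fps add_ac)
  have G0: "G 0 = (A + 1) * G 1 + u * G 2"
  proof -
    have "G 0 = (fps_const (a + 1) * besselI_fps (a + 1) + fps_X * besselI_fps (a + 2)) oo u"
      unfolding G_def using besselI_fps_contiguous[of a] by simp
    also have "\<dots> = fps_const (a + 1) * G 1 + u * G 2"
      by (simp add: fps_compose_add_distrib fps_compose_mult_distrib G_def)
    finally show ?thesis by (simp add: A_def flip: fps_const_add)
  qed
  define F where "F = kummer_fps \<mu>"
  have F: "F = E * G 0" by (simp add: F_def kummer_fps_def E_def G_def u_def a_def)
  have E': "fps_deriv E = - h * E" by (simp add: E_def h_def flip: fps_const_neg)
  have F1: "fps_deriv F = E * (G 1 * (h ^ 3 * X) - h * G 0)"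
    unfolding F by (simp add: E' G') algebra
  have F2: "fps_deriv (fps_deriv F) = E * (G 2 * (h ^ 3 * X) * (h ^ 3 * X) + G 1 * h ^ 3 - 2 * h * G 1 * (h ^ 3 * X) + h * h * G 0)"
    unfolding F1 by (simp add: E' G' fps_deriv_power numeral_2_eq_2) algebra
  have "X * fps_deriv (fps_deriv F) + 2 * B * fps_deriv F + X * fps_deriv F + B * F = 0"
    unfolding F2 unfolding F1 unfolding F B G0 u using h by algebra
  moreover have "2 * B = fps_const (2 * b)" by (simp add: B_def numeral_fps_const)
  ultimately have "X * fps_deriv (fps_deriv F) + fps_const (2 * b) * fps_deriv F + X * fps_deriv F + fps_const b * F = 0"
    by (simp only: B_def)
  then have "(X * fps_deriv (fps_deriv F) + fps_const (2 * b) * fps_deriv F + X * fps_deriv F + fps_const b * F) $ n = 0"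
    by simp
  then have "(of_nat n + 1) * (of_nat n + 2*b) * F $ Suc n + (of_nat n + b) * F $ n = 0"
    by (cases n; simp add: X_def; simp add: algebra_simps)
  then show ?thesis unfolding F_def by algebra
qed

text \<open>The factors of \<open>genG_eq\<close> are expanded separately; the Kummer series may be
  composed with \<open>x t/(1-t)\<close> because that has zero constant term.\<close>

lemma genG_has_fps_expansion:
  fixes x :: real
  assumes "x > 0"
  defines "Q \<equiv> inverse (1 - fps_X :: complex fps)"
  shows "(\<lambda>t. genG \<mu> l t x) has_fps_expansion
     fps_const (of_real (sqrt pi)) * ((fps_binomial (of_nat l - (\<mu> + 1) / 2) oo (- fps_X))
        * (kummer_fps \<mu> oo (fps_const (of_real x) * (fps_X * Q)))
        * (\<Sum>k\<le>l. fps_const (bessel_coeff l k * of_real x ^ k) * Q ^ k))"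
proof -
  have Q: "(\<lambda>t. inverse (1 - t)) has_fps_expansion Q"
    unfolding Q_def by (intro has_fps_expansion_inverse has_fps_expansion_diff fps_expansion_intros) simp
  have "((\<lambda>t. (1 + t) powr (of_nat l - (\<mu> + 1) / 2)) \<circ> (\<lambda>t. - t)) has_fps_expansion
      (fps_binomial (of_nat l - (\<mu> + 1) / 2) oo (- fps_X))"
    by (rule has_fps_expansion_compose[OF has_fps_expansion_binomial_complex])
       (intro fps_expansion_intros, simp)
  then have R: "(\<lambda>t. (1 - t) powr (of_nat l - (\<mu> + 1) / 2)) has_fps_expansion
      (fps_binomial (of_nat l - (\<mu> + 1) / 2) oo (- fps_X))"
    by (simp add: o_def)
  have "(\<lambda>t. of_real x * (t * inverse (1 - t))) has_fps_expansion (fps_const (of_real x) * (fps_X * Q))"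
    by (intro has_fps_expansion_cmult_left has_fps_expansion_mult Q fps_expansion_intros)
  then have K: "((\<lambda>s. exp (- s / 2) * besselI_tilde (\<mu> / 2) (s / 2)) \<circ> (\<lambda>t. of_real x * (t * inverse (1 - t))))
      has_fps_expansion (kummer_fps \<mu> oo (fps_const (of_real x) * (fps_X * Q)))"
    by (rule has_fps_expansion_compose[OF kummer_has_fps_expansion]) simp
  have P: "(\<lambda>t. \<Sum>k\<le>l. (bessel_coeff l k * of_real x ^ k) * inverse (1 - t) ^ k) has_fps_expansion
      (\<Sum>k\<le>l. fps_const (bessel_coeff l k * of_real x ^ k) * Q ^ k)"
    by (intro has_fps_expansion_sum has_fps_expansion_cmult_left has_fps_expansion_power Q)
  have "eventually (\<lambda>t. t \<in> - {1 :: complex}) (nhds 0)"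
    by (intro eventually_nhds_in_open) auto
  then have "eventually (\<lambda>t. of_real (sqrt pi) * ((1 - t) powr (of_nat l - (\<mu> + 1) / 2)
      * ((\<lambda>s. exp (- s / 2) * besselI_tilde (\<mu> / 2) (s / 2)) \<circ> (\<lambda>t. of_real x * (t * inverse (1 - t)))) t
      * (\<Sum>k\<le>l. (bessel_coeff l k * of_real x ^ k) * inverse (1 - t) ^ k))
      = genG \<mu> l t x) (nhds 0)"
  proof eventually_elim
    case (elim t)
    have "poly (bessel_poly l) w = (\<Sum>k\<le>l. bessel_coeff l k * w ^ k)" for w
      by (simp add: bessel_poly_def poly_sum poly_monom)
    moreover have "t * of_real x / (1 - t) = of_real x * (t * inverse (1 - t))"
      "of_real x / (1 - t) = of_real x * inverse (1 - t)"
      by (simp_all add: divide_inverse)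
    moreover have "t \<noteq> 1" using elim by simp
    ultimately show ?case
      by (simp only: genG_eq[OF \<open>x > 0\<close> \<open>t \<noteq> 1\<close>] o_def power_mult_distrib mult.assoc)
  qed
  from iffD1[OF has_fps_expansion_cong[OF this refl]
      has_fps_expansion_cmult_left[OF has_fps_expansion_mult[OF has_fps_expansion_mult[OF R K] P]]]
  show ?thesis .
qed

text \<open>As \<open>G\<close> has no constant term, \<open>G ^ n\<close> contributes nothing below
  index \<open>n\<close>; every inner sum may thus run up to the common bound \<open>j\<close>, and
  the sums can be swapped.\<close>

lemma fps_compose_nth_mult:
  fixes F G H :: "complex fps"
  assumes "G $ 0 = 0"
  shows "((F oo G) * H) $ j = (\<Sum>n\<le>j. F $ n * (G ^ n * H) $ j)"
proof -
  have "((F oo G) * H) $ j = (\<Sum>i\<le>j. (\<Sum>n\<le>j. F $ n * G ^ n $ i) * H $ (j - i))"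
    unfolding fps_mult_nth atLeast0AtMost
  proof (rule sum.cong[OF refl])
    fix i assume "i \<in> {..j}"
    then have "(\<Sum>n\<le>j. F $ n * G ^ n $ i) = (\<Sum>n\<le>i. F $ n * G ^ n $ i)"
      using startsby_zero_power_prefix[OF assms] by (intro sum.mono_neutral_right) auto
    then show "(F oo G) $ i * H $ (j - i) = (\<Sum>n\<le>j. F $ n * G ^ n $ i) * H $ (j - i)"
      by (simp add: fps_compose_nth atLeast0AtMost)
  qed
  also have "\<dots> = (\<Sum>n\<le>j. \<Sum>i\<le>j. F $ n * G ^ n $ i * H $ (j - i))"
    unfolding sum_distrib_right by (rule sum.swap)
  also have "\<dots> = (\<Sum>n\<le>j. F $ n * (G ^ n * H) $ j)"
    by (simp add: fps_mult_nth atLeast0AtMost sum_distrib_left mult.assoc)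
  finally show ?thesis .
qed

subsection \<open>The differential equation\<close>

text \<open>\<open>C0, C1, C2\<close> stand for \<open>c\<close> at \<open>n, n-1, n-2\<close> and
  \<open>D0, D1, D2\<close> for \<open>d\<close> at \<open>k, k-1, k-2\<close>. The recurrences
  enter as equations without division, so indices where a factor vanishes are included.\<close>

lemma six_term_relation:
  fixes n k b l C0 C1 C2 D0 D1 D2 :: complex
  assumes c1: "n * (n + 2*b - 1) * C0 + (n - 1 + b) * C1 = 0"
    and c2: "(n - 1) * (n + 2*b - 2) * C1 + (n - 2 + b) * C2 = 0"
    and d1: "k * (k - 2*l - 1) * D0 - (k - 1 - l) * D1 = 0"
    and d2: "(k - 1) * (k - 2*l - 2) * D1 - (k - 2 - l) * D2 = 0"
    and N: "N = n + k" and a: "a = N - 2 - l + b"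
    and al: "\<alpha> = N * (N - 2*l - 1) * (N + 2*b - 1) * (N + 2*b - 2*l - 2)"
    and be: "\<beta> = - (N - 1 - l) * (N + 2*b - 1) * (N + 2*b - 2 - 2*l)
                - (N - 1) * (N - 2*l - 2) * (N + 2*b - 2 - l)"
    and ga: "\<gamma> = (N - 2 - l) * (N - 2 + 2*b - l)"
  shows "\<alpha> * C0 * D0 + \<beta> * (C0 * D1 - C1 * D0) + \<gamma> * (C0 * D2 - 2 * C1 * D1 + C2 * D0)
    = n * (n + 2*b) * C0 * D2
      + (a * (2*n - 1 + 2*b) - 2 * (n - 1) * (n - 1 + 2*b)) * C1 * D1
      + ((n - 2) * (n - 2 + 2*b) - a * (2*n - 4 + 2*b) + a\<^sup>2) * C2 * D0"
proof -
  \<comment> \<open>The cofactors were found by solving a linear system for their coefficients.\<close>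
  define m where "m = 2*b - 1"
  define p0 where "p0 = 1 + 4*l + 4*l^2 - m - 2*m*l - 6*k - 12*k*l + 2*k*m + 6*k^2 - 2*n - 4*n*l + n*m + 4*n*k + n^2"
  define p1 where "p1 = 6 + 6*l - m - 6*k - 2*n"
  define r0 where "r0 = b - 2 - 2*l + 2*k + n"
  define s0 where "s0 = m^2 - m - 2*m*l - k - 2*k*l + 2*k*m + k^2 - 2*n - 4*n*l + 4*n*k"
  define s1 where "s1 = 2*k - 2*l - 1"
  define t0 where "t0 = 1 + l - m - k - 2*n"
  have "\<alpha> * C0 * D0 + \<beta> * (C0 * D1 - C1 * D0) + \<gamma> * (C0 * D2 - 2 * C1 * D1 + C2 * D0)
    - (n * (n + 2*b) * C0 * D2
      + (a * (2*n - 1 + 2*b) - 2 * (n - 1) * (n - 1 + 2*b)) * C1 * D1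
      + ((n - 2) * (n - 2 + 2*b) - a * (2*n - 4 + 2*b) + a\<^sup>2) * C2 * D0)
    = (p0 * D0 + p1 * D1) * (n * (n + 2*b - 1) * C0 + (n - 1 + b) * C1)
      + r0 * D0 * ((n - 1) * (n + 2*b - 2) * C1 + (n - 2 + b) * C2)
      + (s0 * C0 + s1 * C1) * (k * (k - 2*l - 1) * D0 - (k - 1 - l) * D1)
      + t0 * C0 * ((k - 1) * (k - 2*l - 2) * D1 - (k - 2 - l) * D2)"
    unfolding p0_def p1_def r0_def s0_def s1_def t0_def m_def al be ga a N by algebra
  then show ?thesis unfolding c1 c2 d1 d2 by simp
qed

text \<open>The coefficient of \<open>x^N\<close> in \<open>x^2\<close> times the differential
  equation. \<open>W\<close> is the power of \<open>1 - t\<close> belonging to \<open>x^N\<close>;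
  multiplying by \<open>1 - fps_X\<close> passes to \<open>x^(N-1)\<close>. The equation for
  \<open>W\<close> lets it be factored out of all \<open>t\<close>-derivatives, after which the
  coefficients of \<open>t^n\<close> are compared.\<close>

lemma fps_recurrence:
  fixes c :: "nat \<Rightarrow> complex" and d :: "int \<Rightarrow> complex" and b l :: complex and N :: nat
  assumes c: "\<And>n. (of_nat n + 1) * (of_nat n + 2*b) * c (Suc n) = - (of_nat n + b) * c n"
    and d: "\<And>k. of_int k * (of_int k - 2*l - 1) * d k = (of_int k - 1 - l) * d (k - 1)"
    and W: "(1 - fps_X) * fps_deriv W = fps_const (of_nat N - l + b) * W"
  defines "h \<equiv> \<lambda>i. Abs_fps (\<lambda>n. c n * d (i - int n))"
    and "\<alpha> \<equiv> of_nat N * (of_nat N - 2*l - 1) * (of_nat N + 2*b - 1) * (of_nat N + 2*b - 2*l - 2)"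
    and "\<beta> \<equiv> - (of_nat N - 1 - l) * (of_nat N + 2*b - 1) * (of_nat N + 2*b - 2 - 2*l)
              - (of_nat N - 1) * (of_nat N - 2*l - 2) * (of_nat N + 2*b - 2 - l)"
    and "\<gamma> \<equiv> (of_nat N - 2 - l) * (of_nat N - 2 + 2*b - l)"
  shows "\<alpha> * (W * h (int N)) $ j + \<beta> * (W * ((1 - fps_X) * h (int N - 1))) $ j
           + \<gamma> * (W * ((1 - fps_X)\<^sup>2 * h (int N - 2))) $ j
       = of_nat j * (of_nat j + 2*b) * (W * ((1 - fps_X)\<^sup>2 * h (int N - 2))) $ j"
proof -
  define X where "X = (fps_X :: complex fps)"
  \<comment> \<open>\<open>W\<close> times \<open>(1 - X)\<^sup>2\<close> behaves like
    \<open>(1-t)^(-a)\<close>, so \<open>a\<close> is the exponent for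
    \<open>x^(N-2)\<close>.\<close>
  define a where "a = of_nat N - 2 - l + b"
  define A where "A = fps_const a"
  define B where "B = fps_const b"
  define H where "H = h (int N - 2)"
  define H' where "H' = X * fps_deriv H"
  define H'' where "H'' = X * fps_deriv H'"
  define Y where "Y = W * ((1 - X)\<^sup>2 * H)"
  have X': "fps_deriv X = 1" by (simp add: X_def)
  have A': "fps_deriv A = 0" by (simp add: A_def)
  have W': "(1 - X) * fps_deriv W = (A + 2) * W"
  proof -
    have "A + 2 = fps_const (of_nat N - l + b)" by (simp add: A_def a_def numeral_fps_const algebra_simps)
    then show ?thesis using W by (simp only: X_def)
  qed
  define Z where "Z = (1 - X) * H' + A * X * H"
  have Y1: "X * fps_deriv Y = W * ((1 - X) * Z)"
  proof -
    have "X * fps_deriv Y = X * (((1 - X) * fps_deriv W) * (1 - X) * H)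
       - 2 * X * W * (1 - X) * H + W * (1 - X)\<^sup>2 * H'"
      unfolding Y_def H'_def by (simp add: X' power2_eq_square) algebra
    then show ?thesis unfolding W' Z_def by algebra
  qed
  have Z': "X * fps_deriv Z = (1 - X) * H'' - X * H' + A * X * H + A * X * H'"
    unfolding Z_def H''_def by (simp add: X' A' H'_def) algebra
  have Y2: "X * fps_deriv (X * fps_deriv Y) = W * ((A + 1) * X * Z + (1 - X) * (X * fps_deriv Z))"
  proof -
    have "X * fps_deriv (X * fps_deriv Y) = X * (((1 - X) * fps_deriv W) * Z) - X * W * Z
       + W * (1 - X) * (X * fps_deriv Z)"
      unfolding Y1 by (simp add: X') algebra
    then show ?thesis unfolding W' by algebra
  qed
  \<comment> \<open>The expansion is written with nested shifts by \<open>X\<close>, so that each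
    coefficient can be read off from \<open>h\<close>, \<open>h1\<close> and \<open>h2\<close>
    below.\<close>
  define L where "L = H'' + 2 * (B * H') + 2 * (A * (X * H')) + A * (X * H) + 2 * (A * (B * (X * H)))
     - 2 * (X * H'') - 4 * (B * (X * H')) + X * (X * H'') + 2 * (B * (X * (X * H')))
     - 2 * (A * (X * (X * H'))) - 2 * (A * (B * (X * (X * H)))) + A * (A * (X * (X * H)))"
  have Y3: "X * fps_deriv (X * fps_deriv Y) + 2 * B * (X * fps_deriv Y) = W * L"
    unfolding Y2 unfolding Y1 Z' unfolding Z_def L_def by algebra
  define G where "G = fps_const \<alpha> * h (int N) + fps_const \<beta> * (h (int N - 1) - X * h (int N - 1))
     + fps_const \<gamma> * (H - 2 * (X * H) + X * (X * H))"
  have "G = L"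
  proof (rule fps_ext)
    fix n :: nat
    define C0 where "C0 = c n"
    \<comment> \<open>Below index zero the value is 0, whereas \<open>c (n - 1)\<close> alone would
      yield \<open>c 0\<close> at \<open>n = 0\<close>.\<close>
    define C1 where "C1 = (if n = 0 then 0 else c (n - 1))"
    define C2 where "C2 = (if n = 0 \<or> n = 1 then 0 else c (n - 2))"
    \<comment> \<open>An integer, since \<open>n\<close> may exceed \<open>N\<close>.\<close>
    define k where "k = int N - int n"
    have c1: "of_nat n * (of_nat n + 2*b - 1) * C0 + (of_nat n - 1 + b) * C1 = 0"
      using c[of "n - 1"] by (cases n) (auto simp: C0_def C1_def algebra_simps)
    have c2: "(of_nat n - 1) * (of_nat n + 2*b - 2) * C1 + (of_nat n - 2 + b) * C2 = 0"
    proof (cases "n = 0 \<or> n = 1")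
      case True then show ?thesis by (auto simp: C1_def C2_def)
    next
      case False
      then obtain i where "n = Suc (Suc i)" by (metis One_nat_def not0_implies_Suc)
      then show ?thesis using c[of i] by (auto simp: C1_def C2_def algebra_simps)
    qed
    have d1: "of_int k * (of_int k - 2*l - 1) * d k - (of_int k - 1 - l) * d (k - 1) = 0"
      using d[of k] by simp
    have d2: "(of_int k - 1) * (of_int k - 2*l - 2) * d (k - 1) - (of_int k - 2 - l) * d (k - 2) = 0"
      using d[of "k - 1"] by (simp add: algebra_simps)
    have N: "of_nat N = of_nat n + (of_int k :: complex)" by (simp add: k_def)
    have h: "h (int N) $ n = C0 * d k" "h (int N - 1) $ n = C0 * d (k - 1)" "H $ n = C0 * d (k - 2)"
      by (simp_all add: H_def h_def C0_def k_def algebra_simps)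
    have H'n: "H' $ n = of_nat n * H $ n" for n by (cases n) (auto simp: H'_def X_def)
    have H''n: "H'' $ n = of_nat n * (of_nat n * H $ n)" for n by (cases n) (auto simp: H''_def X_def H'n)
    have h1: "(X * h (int N - 1)) $ n = C1 * d k" "(X * H) $ n = C1 * d (k - 1)"
        "(X * H') $ n = (of_nat n - 1) * (C1 * d (k - 1))"
        "(X * H'') $ n = (of_nat n - 1) * ((of_nat n - 1) * (C1 * d (k - 1)))"
      by (cases n; simp add: H'n H''n; simp add: X_def H_def h_def C1_def k_def algebra_simps)+
    have h2: "(X * (X * H)) $ n = C2 * d k"
        "(X * (X * H')) $ n = (of_nat n - 2) * (C2 * d k)"
        "(X * (X * H'')) $ n = (of_nat n - 2) * ((of_nat n - 2) * (C2 * d k))"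
      by (cases n rule: nat_cases2;
          simp add: H'n H''n X_def H_def h_def C2_def k_def of_nat_diff algebra_simps)+
    note core = six_term_relation[OF c1 c2 d1 d2 N a_def \<alpha>_def[THEN meta_eq_to_obj_eq] \<beta>_def[THEN meta_eq_to_obj_eq] \<gamma>_def[THEN meta_eq_to_obj_eq]]
    have "G $ n = \<alpha> * C0 * d k + \<beta> * (C0 * d (k-1) - C1 * d k)
                  + \<gamma> * (C0 * d (k-2) - 2 * C1 * d (k-1) + C2 * d k)"
      unfolding G_def by (simp add: h h1 h2; simp add: algebra_simps)
    also have "\<dots> = L $ n"
      unfolding core L_def A_def B_def
      by (simp add: h h1 h2 H'n H''n; simp add: algebra_simps power2_eq_square)
    finally show "G $ n = L $ n" .
  qed
  have "\<alpha> * (W * h (int N)) $ j + \<beta> * (W * ((1 - fps_X) * h (int N - 1))) $ j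
           + \<gamma> * (W * ((1 - fps_X)\<^sup>2 * h (int N - 2))) $ j = (W * G) $ j"
  proof -
    have "W * G = fps_const \<alpha> * (W * h (int N)) + fps_const \<beta> * (W * ((1 - fps_X) * h (int N - 1)))
       + fps_const \<gamma> * (W * ((1 - fps_X)\<^sup>2 * h (int N - 2)))"
      unfolding G_def H_def X_def by algebra
    then show ?thesis by simp
  qed
  also have "\<dots> = (X * fps_deriv (X * fps_deriv Y) + 2 * B * (X * fps_deriv Y)) $ j"
    unfolding Y3 \<open>G = L\<close> ..
  also have "2 * B = fps_const (2 * b)" by (simp add: B_def numeral_fps_const)
  also have "(X * fps_deriv (X * fps_deriv Y) + fps_const (2 * b) * (X * fps_deriv Y)) $ j
     = of_nat j * (of_nat j + 2*b) * Y $ j"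
    by (cases j) (auto simp: X_def algebra_simps)
  finally show ?thesis by (simp add: Y_def H_def X_def)
qed

text \<open>
  With zero coefficients at negative indices the recurrence for the coefficients holds at every
  integer, which avoids boundary cases.
\<close>
definition bessel_coeff_int :: "nat \<Rightarrow> int \<Rightarrow> complex" where
  "bessel_coeff_int l k = (if k < 0 then 0 else bessel_coeff l (nat k))"

lemma bessel_coeff_int_rec:
  "of_int k * (of_int k - 2 * of_nat l - 1) * bessel_coeff_int l k
     = (of_int k - 1 - of_nat l) * bessel_coeff_int l (k - 1)"
proof (cases "k > 0")
  case True
  then obtain m where "k = int (Suc m)" by (metis zero_less_imp_eq_int gr0_implies_Suc)
  then have "bessel_coeff_int l k = bessel_coeff l (Suc m)" "bessel_coeff_int l (k - 1) = bessel_coeff l m"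
      "of_int k = (of_nat m + 1 :: complex)"
    by (simp_all add: bessel_coeff_int_def nat_add_distrib)
  then show ?thesis using bessel_coeff_Suc[of m l] by (simp add: add_ac)
qed (auto simp: bessel_coeff_int_def)

section \<open>The coefficients of the polynomials and their recurrence\<close>

definition M_fps :: "complex \<Rightarrow> nat \<Rightarrow> int \<Rightarrow> complex fps" where
  "M_fps \<mu> l i = Abs_fps (\<lambda>n. kummer_fps \<mu> $ n * bessel_coeff_int l (i - int n))"

text \<open>The expansion of \<open>(1-t)^(l-b-m)\<close> with \<open>b = (\<mu>+1)/2\<close>;
  \<open>M_fps \<mu> l m\<close> is the accompanying series \<open>h\<^sub>m\<close>.\<close>

definition W_fps :: "complex \<Rightarrow> nat \<Rightarrow> nat \<Rightarrow> complex fps" where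
  "W_fps \<mu> l m = (fps_binomial (of_nat l - (\<mu> + 1) / 2) oo (- fps_X)) * inverse (1 - fps_X) ^ m"

lemma W_fps_Suc: "W_fps \<mu> l (Suc m) * (1 - fps_X) = W_fps \<mu> l m"
proof -
  have "inverse (1 - fps_X) * (1 - fps_X) = (1 :: complex fps)" by (rule inverse_mult_eq_1) simp
  moreover have "W_fps \<mu> l (Suc m) * (1 - fps_X) = W_fps \<mu> l m * (inverse (1 - fps_X) * (1 - fps_X))"
    unfolding W_fps_def power_Suc by (simp only: mult_ac)
  ultimately show ?thesis by simp
qed

lemma W_fps_nth_0: "W_fps \<mu> l m $ 0 = 1"
  by (simp add: W_fps_def fps_power_zeroth fps_inverse_def)

text \<open>The base case is the binomial equation composed with \<open>-t\<close>. Each further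
  factor \<open>1/(1-t)\<close> adds one to the constant, after cancelling \<open>1 - fps_X\<close>
  in the integral domain of power series.\<close>

lemma W_fps_ODE:
  "(1 - fps_X) * fps_deriv (W_fps \<mu> l m) = fps_const (of_nat m - of_nat l + (\<mu> + 1) / 2) * W_fps \<mu> l m"
proof (induction m)
  case 0
  define c where "c = of_nat l - (\<mu> + 1) / 2"
  have "(1 + fps_X) * fps_deriv (fps_binomial c) = fps_const c * fps_binomial c"
  proof -
    have "(1 + fps_X) * (x * inverse (1 + fps_X)) = x" for x :: "complex fps"
    proof -
      have "(1 + fps_X) * inverse (1 + fps_X) = (1 :: complex fps)"
        by (rule inverse_mult_eq_1') simp
      then have "x * ((1 + fps_X) * inverse (1 + fps_X)) = x" by simp
      then show ?thesis by (simp only: mult_ac)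
    qed
    then show ?thesis by (simp add: fps_binomial_deriv fps_divide_unit)
  qed
  then have "((1 + fps_X) * fps_deriv (fps_binomial c)) oo (- fps_X) = (fps_const c * fps_binomial c) oo (- fps_X)"
    by simp
  then have "(1 - fps_X) * (fps_deriv (fps_binomial c) oo (- fps_X)) = fps_const c * (fps_binomial c oo (- fps_X))"
    by (simp add: fps_compose_mult_distrib fps_compose_add_distrib)
  moreover have "fps_deriv (fps_binomial c oo (- fps_X)) = - (fps_deriv (fps_binomial c) oo (- fps_X))"
    by (subst fps_compose_deriv) simp_all
  ultimately have "(1 - fps_X) * fps_deriv (fps_binomial c oo (- fps_X)) = fps_const (- c) * (fps_binomial c oo (- fps_X))"
    by (simp del: fps_const_neg add: fps_const_neg[symmetric])
  moreover have "- c = of_nat 0 - of_nat l + (\<mu> + 1) / 2" by (simp add: c_def)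
  ultimately show ?case by (simp add: W_fps_def c_def)
next
  case (Suc m)
  define V where "V = W_fps \<mu> l (Suc m)"
  define e where "e = fps_const (of_nat m - of_nat l + (\<mu> + 1) / 2)"
  have "fps_deriv (V * (1 - fps_X)) = fps_deriv V * (1 - fps_X) - V" by simp
  then have "(1 - fps_X) * (fps_deriv V * (1 - fps_X) - V) = e * (V * (1 - fps_X))"
    using Suc W_fps_Suc[of \<mu> l m] by (simp add: V_def e_def)
  then have "(1 - fps_X) * ((1 - fps_X) * fps_deriv V) = (1 - fps_X) * ((e + 1) * V)"
    by algebra
  moreover have "1 - fps_X \<noteq> (0 :: complex fps)"
    by (simp add: fps_eq_iff exI[of _ 0])
  ultimately have "(1 - fps_X) * fps_deriv V = (e + 1) * V" by simp
  moreover have "e + 1 = fps_const (of_nat (Suc m) - of_nat l + (\<mu> + 1) / 2)"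
    by (simp add: e_def flip: fps_const_1_eq_1)
  ultimately show ?case by (simp add: V_def)
qed

text \<open>The coefficient of \<open>t^j x^m\<close> in the generating function, without the factor
  \<open>sqrt pi\<close>.\<close>

definition M_coeff :: "complex \<Rightarrow> nat \<Rightarrow> nat \<Rightarrow> nat \<Rightarrow> complex" where
  "M_coeff \<mu> l j m = (W_fps \<mu> l m * M_fps \<mu> l (int m)) $ j"

lemma M_coeff_eq:
  "M_coeff \<mu> l j m = (\<Sum>n\<le>j. kummer_fps \<mu> $ n * bessel_coeff_int l (int m - int n) * W_fps \<mu> l m $ (j - n))"
  unfolding M_coeff_def by (subst mult.commute) (simp add: fps_mult_nth M_fps_def atLeast0AtMost)

lemma M_coeff_eq_0:
  assumes "m > j + l"
  shows "M_coeff \<mu> l j m = 0"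
  unfolding M_coeff_eq by (rule sum.neutral) (use assms in \<open>auto simp: bessel_coeff_int_def bessel_coeff_def\<close>)

text \<open>Only \<open>n = j\<close> survives, and its other two factors are 1. For uniqueness this
  reduces the leading coefficient to a Kummer coefficient.\<close>

lemma M_coeff_top: "M_coeff \<mu> l j (j + l) = kummer_fps \<mu> $ j"
proof -
  have "M_coeff \<mu> l j (j + l) = (\<Sum>n\<in>{j}. kummer_fps \<mu> $ n * bessel_coeff_int l (int (j + l) - int n) * W_fps \<mu> l (j + l) $ (j - n))"
    unfolding M_coeff_eq
    by (rule sum.mono_neutral_right) (auto simp: bessel_coeff_int_def bessel_coeff_def)
  then show ?thesis by (simp add: W_fps_nth_0 bessel_coeff_int_def bessel_coeff_def)
qed

text \<open>At index \<open>k\<close> the coefficient criterion is \<open>fps_recurrence\<close>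
  with \<open>N = k\<close>: by \<open>W_fps_Suc\<close> its three products are the coefficients of
  \<open>q\<close> at \<open>k\<close>, \<open>k-1\<close> and \<open>k-2\<close>.\<close>

lemma M_coeff_rec:
  fixes \<mu> :: complex and l j :: nat
  defines "A \<equiv> \<lambda>m. M_coeff \<mu> l j m"
  defines "q \<equiv> \<Sum>m\<le>j + l. monom (A m) m"
  shows "\<forall>x::real>0. opP \<mu> l (\<lambda>y. poly q (of_real y)) x = of_nat j * (of_nat j + \<mu> + 1) * poly q (of_real x)"
  unfolding opP_poly_eq_iff
proof
  fix k :: nat
  define b where "b = (\<mu> + 1) / 2"
  have b: "of_nat k + 2 * b - 1 = of_nat k + \<mu>"
    "of_nat k + 2 * b - 2 * of_nat l - 2 = of_nat k + \<mu> - 2 * of_nat l - 1"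
    "of_nat k + 2 * b - 2 - 2 * of_nat l = of_nat k + \<mu> - 1 - 2 * of_nat l"
    "of_nat k + 2 * b - 2 - of_nat l = of_nat k + \<mu> - 1 - of_nat l"
    "of_nat k - 2 + 2 * b - of_nat l = of_nat k - 1 + \<mu> - of_nat l"
    "of_nat j + 2 * b = of_nat j + \<mu> + 1"
    by (simp_all add: b_def field_simps)
  have cq: "coeff q m = A m" for m
    using M_coeff_eq_0[of j l m \<mu>] by (auto simp: q_def coeff_sum A_def not_le)
  define W where "W = W_fps \<mu> l k"
  define h where "h = M_fps \<mu> l"
  \<comment> \<open>This settles \<open>k = 0\<close> and \<open>k = 1\<close>, where the shifted
    coefficients are zero.\<close>
  have hneg: "h i = 0" if "i < 0" for i
    using that by (intro fps_ext) (auto simp: h_def M_fps_def bessel_coeff_int_def)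
  have 0: "(W * h (int k)) $ j = coeff q k" by (simp add: cq A_def M_coeff_def W_def h_def)
  have 1: "(W * ((1 - fps_X) * h (int k - 1))) $ j = coeff (pCons 0 q) k"
  proof (cases k)
    case (Suc m)
    have "W * (1 - fps_X) = W_fps \<mu> l m" unfolding W_def Suc by (rule W_fps_Suc)
    then show ?thesis using Suc by (simp add: cq A_def M_coeff_def h_def flip: mult.assoc)
  qed (simp add: hneg)
  have 2: "(W * ((1 - fps_X)\<^sup>2 * h (int k - 2))) $ j = coeff (pCons 0 (pCons 0 q)) k"
  proof (cases k rule: nat_cases2)
    case (3 m)
    have "W * (1 - fps_X)\<^sup>2 = W_fps \<mu> l m"
      unfolding W_def 3 power2_eq_square by (simp only: W_fps_Suc flip: mult.assoc)
    then show ?thesis using 3 by (simp add: cq A_def M_coeff_def h_def flip: mult.assoc)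
  qed (simp_all add: hneg)
  note rec = fps_recurrence[where c = "\<lambda>n. kummer_fps \<mu> $ n" and b = b and d = "bessel_coeff_int l" and l = "of_nat l" and W = W and N = k and j = j,
      OF kummer_fps_nth_Suc[OF b_def] bessel_coeff_int_rec W_fps_ODE[of \<mu> l k, folded W_def b_def],
      folded M_fps_def, folded h_def, unfolded 0 1 2]
  show "of_nat k * (of_nat k - 2 * of_nat l - 1) * (of_nat k + \<mu>) * (of_nat k + \<mu> - 2 * of_nat l - 1) * coeff q k
     + (- (of_nat k - 1 - of_nat l) * (of_nat k + \<mu>) * (of_nat k + \<mu> - 1 - 2 * of_nat l)
              - (of_nat k - 1) * (of_nat k - 2 * of_nat l - 2) * (of_nat k + \<mu> - 1 - of_nat l)) * coeff (pCons 0 q) k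
     + (of_nat k - 2 - of_nat l) * (of_nat k - 1 + \<mu> - of_nat l) * coeff (pCons 0 (pCons 0 q)) k
     = of_nat j * (of_nat j + \<mu> + 1) * coeff (pCons 0 (pCons 0 q)) k"
    using rec unfolding b .
qed

text \<open>Term \<open>n\<close> of the Kummer series and term \<open>k\<close> of the Bessel
  polynomial contribute \<open>x^(n+k) t^n (1-t)^(l-b-n-k)\<close>; collecting by
  \<open>m = n + k\<close> gives \<open>M_coeff\<close>.\<close>

lemma polyM_eq:
  fixes x :: real
  assumes "x > 0"
  shows "polyM \<mu> l j x = Gamma (of_nat j + \<mu> + 1) / (2 powr \<mu> * Gamma (of_nat j + (\<mu> + 1) / 2)) * of_real (sqrt pi)
      * poly (\<Sum>m\<le>j + l. monom (M_coeff \<mu> l j m) m) (of_real x)"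
proof -
  define X where "X = complex_of_real x"
  define Q where "Q = inverse (1 - fps_X :: complex fps)"
  define R where "R = fps_binomial (of_nat l - (\<mu> + 1) / 2) oo (- fps_X)"
  define G where "G = fps_const X * (fps_X * Q)"
  define T where "T = (\<Sum>k\<le>l. fps_const (bessel_coeff l k * X ^ k) * Q ^ k)"
  have "(R * (kummer_fps \<mu> oo G) * T) $ j = ((kummer_fps \<mu> oo G) * (R * T)) $ j"
    by (simp add: mult_ac)
  also have "\<dots> = (\<Sum>n\<le>j. kummer_fps \<mu> $ n * (G ^ n * (R * T)) $ j)"
    by (rule fps_compose_nth_mult) (simp add: G_def)
  also have "\<dots> = (\<Sum>n\<le>j. \<Sum>m\<le>j + l. kummer_fps \<mu> $ n * bessel_coeff_int l (int m - int n) * W_fps \<mu> l m $ (j - n) * X ^ m)"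
  proof (rule sum.cong[OF refl])
    fix n assume n: "n \<in> {..j}"
    have "G ^ n * (R * T) = (\<Sum>k\<le>l. fps_const (bessel_coeff l k * X ^ (n + k)) * (fps_X ^ n * W_fps \<mu> l (n + k)))"
      unfolding T_def sum_distrib_left
    proof (rule sum.cong[OF refl])
      fix k
      have "G ^ n = fps_const (X ^ n) * fps_X ^ n * Q ^ n"
        by (simp add: G_def power_mult_distrib fps_const_power)
      then show "G ^ n * (R * (fps_const (bessel_coeff l k * X ^ k) * Q ^ k)) =
         fps_const (bessel_coeff l k * X ^ (n + k)) * (fps_X ^ n * W_fps \<mu> l (n + k))"
        by (simp add: W_fps_def R_def Q_def power_add flip: fps_const_mult)
    qed
    then have "(G ^ n * (R * T)) $ j = (\<Sum>k\<le>l. bessel_coeff l k * X ^ (n + k) * W_fps \<mu> l (n + k) $ (j - n))"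
      using n by (simp add: fps_sum_nth fps_X_power_mult_nth)
    also have "\<dots> = (\<Sum>m\<in>(+) n ` {..l}. bessel_coeff_int l (int m - int n) * X ^ m * W_fps \<mu> l m $ (j - n))"
      by (subst sum.reindex) (auto simp: bessel_coeff_int_def)
    \<comment> \<open>The added terms have index \<open>m - n\<close> outside \<open>0..l\<close>,
      hence are zero; the range no longer depends on \<open>n\<close>, so the sums can be
      swapped.\<close>
    also have "\<dots> = (\<Sum>m\<le>j + l. bessel_coeff_int l (int m - int n) * X ^ m * W_fps \<mu> l m $ (j - n))"
    proof (rule sum.mono_neutral_left)
      show "\<forall>m\<in>{..j + l} - (+) n ` {..l}. bessel_coeff_int l (int m - int n) * X ^ m * W_fps \<mu> l m $ (j - n) = 0"
      proof
        fix m assume m: "m \<in> {..j + l} - (+) n ` {..l}"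
        have "m < n \<or> m - n > l"
        proof (rule ccontr)
          assume "\<not> (m < n \<or> m - n > l)"
          then have "m = n + (m - n)" "m - n \<in> {..l}" by auto
          then show False using m by blast
        qed
        then show "bessel_coeff_int l (int m - int n) * X ^ m * W_fps \<mu> l m $ (j - n) = 0"
          by (auto simp: bessel_coeff_int_def bessel_coeff_def nat_diff_distrib)
      qed
    qed (use n in auto)
    finally show "kummer_fps \<mu> $ n * (G ^ n * (R * T)) $ j =
        (\<Sum>m\<le>j + l. kummer_fps \<mu> $ n * bessel_coeff_int l (int m - int n) * W_fps \<mu> l m $ (j - n) * X ^ m)"
      by (simp add: sum_distrib_left mult_ac)
  qed
  also have "\<dots> = (\<Sum>m\<le>j + l. M_coeff \<mu> l j m * X ^ m)"
    unfolding M_coeff_eq sum_distrib_right by (rule sum.swap)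
  also have "\<dots> = poly (\<Sum>m\<le>j + l. monom (M_coeff \<mu> l j m) m) X"
    by (simp add: poly_sum poly_monom)
  finally have "(R * (kummer_fps \<mu> oo G) * T) $ j = poly (\<Sum>m\<le>j + l. monom (M_coeff \<mu> l j m) m) X" .
  moreover have "(deriv ^^ j) (\<lambda>t. genG \<mu> l t x) 0 = fact j * (of_real (sqrt pi) * (R * (kummer_fps \<mu> oo G) * T) $ j)"
  proof -
    have "(fps_const (of_real (sqrt pi)) * (R * (kummer_fps \<mu> oo G) * T)) $ j = (deriv ^^ j) (\<lambda>t. genG \<mu> l t x) 0 / fact j"
      unfolding R_def G_def T_def Q_def X_def
      by (rule fps_nth_fps_expansion[OF genG_has_fps_expansion[OF assms]])
    then show ?thesis by (simp only: fps_mult_left_const_nth) (simp add: field_simps)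
  qed
  ultimately show ?thesis
    by (simp add: polyM_def X_def field_simps)
qed

theorem theorem2p3:
  fixes \<mu> :: complex and l :: nat
  assumes "\<forall>n::nat. \<mu> \<noteq> - of_nat (Suc n)"
  shows "(\<forall>j::nat.
           (\<exists>q :: complex poly. \<forall>x::real>0. polyM \<mu> l j x = poly q (of_real x))
         \<and> (\<forall>x::real>0. opP \<mu> l (polyM \<mu> l j) x
                = of_nat j * (of_nat j + \<mu> + 1) * polyM \<mu> l j x))
       \<and> (\<forall>r::real. \<mu> = of_real r \<and> r \<ge> 2 * real l + 1 \<longrightarrow>
         (\<forall>j::nat. \<forall>p :: complex poly.
           (\<forall>x::real>0. opP \<mu> l (\<lambda>y. poly p (of_real y)) x
                = of_nat j * (of_nat j + \<mu> + 1) * poly p (of_real x))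
           \<longrightarrow> (\<exists>c. \<forall>x::real>0. poly p (of_real x) = c * polyM \<mu> l j x)))"
proof (intro conjI allI impI; (elim conjE)?)
  fix j :: nat
  define q where "q = (\<Sum>m\<le>j + l. monom (M_coeff \<mu> l j m) m)"
  define K where "K = Gamma (of_nat j + \<mu> + 1) / (2 powr \<mu> * Gamma (of_nat j + (\<mu> + 1) / 2)) * of_real (sqrt pi)"
  have M: "polyM \<mu> l j x = poly (smult K q) (of_real x)" if "x > 0" for x
    using polyM_eq[OF that, of \<mu> l j] by (simp add: q_def K_def)
  then show "\<exists>q. \<forall>x::real>0. polyM \<mu> l j x = poly q (of_real x)" by blast
  have "\<forall>x::real>0. opP \<mu> l (\<lambda>y. poly q (of_real y)) x = of_nat j * (of_nat j + \<mu> + 1) * poly q (of_real x)"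
    unfolding q_def by (rule M_coeff_rec)
  then have "\<forall>x::real>0. opP \<mu> l (\<lambda>y. poly (smult K q) (of_real y)) x = of_nat j * (of_nat j + \<mu> + 1) * poly (smult K q) (of_real x)"
    by (rule opP_poly_smult)
  moreover fix x :: real assume "x > 0"
  ultimately show "opP \<mu> l (polyM \<mu> l j) x = of_nat j * (of_nat j + \<mu> + 1) * polyM \<mu> l j x"
    using opP_cong[of "polyM \<mu> l j" "\<lambda>y. poly (smult K q) (of_real y)" x \<mu> l] M by simp
next
  fix r :: real and j :: nat and p :: "complex poly"
  assume \<mu>: "\<mu> = of_real r" and r: "r \<ge> 2 * real l + 1"
    and p: "\<forall>x::real>0. opP \<mu> l (\<lambda>y. poly p (of_real y)) x = of_nat j * (of_nat j + \<mu> + 1) * poly p (of_real x)"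
  define q where "q = (\<Sum>m\<le>j + l. monom (M_coeff \<mu> l j m) m)"
  define K where "K = Gamma (of_nat j + \<mu> + 1) / (2 powr \<mu> * Gamma (of_nat j + (\<mu> + 1) / 2)) * of_real (sqrt pi)"
  have M: "polyM \<mu> l j x = K * poly q (of_real x)" if "x > 0" for x
    using polyM_eq[OF that, of \<mu> l j] by (simp add: q_def K_def)
  have q: "\<forall>x::real>0. opP \<mu> l (\<lambda>y. poly q (of_real y)) x = of_nat j * (of_nat j + \<mu> + 1) * poly q (of_real x)"
    unfolding q_def by (rule M_coeff_rec)
  have pos: "w \<notin> \<int>\<^sub>\<le>\<^sub>0" if "Re w > 0" for w :: complex
    using that by (auto elim!: nonpos_Ints_cases)
  have "r \<ge> 1" using r of_nat_0_le_iff[of l, where 'a=real] by linarith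
  then have "0 < real j + r + 1" "0 < real j + (r + 1) / 2" by (auto intro!: add_nonneg_pos)
  \<comment> \<open>\<open>Gamma\<close> takes the value 0 exactly at its poles, so positive real
    part suffices.\<close>
  then have "Gamma (of_nat j + \<mu> + 1) \<noteq> 0" "Gamma (of_nat j + (\<mu> + 1) / 2) \<noteq> 0"
    unfolding Gamma_eq_zero_iff by (intro pos; simp add: \<mu>)+
  then have K: "K \<noteq> 0" by (simp add: K_def)
  \<comment> \<open>The recurrence propagates nonvanishing because \<open>n + (\<mu>+1)/2\<close> is
    positive; thus \<open>q\<close> has a nonzero coefficient at \<open>j + l\<close>.\<close>
  have "kummer_fps \<mu> $ n \<noteq> 0" for n
  proof (induction n)
    case 0
    then show ?case using r \<mu> pos[of "\<mu> / 2 + 1"] by (simp add: kummer_fps_nth_0 rGamma_inverse_Gamma Gamma_eq_zero_iff)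
  next
    case (Suc n)
    have "0 < real n + (r + 1) / 2" using \<open>r \<ge> 1\<close> by (simp add: add_nonneg_pos)
    moreover have "of_nat n + (\<mu> + 1) / 2 = of_real (real n + (r + 1) / 2)" by (simp add: \<mu>)
    ultimately have "of_nat n + (\<mu> + 1) / 2 \<noteq> 0" by (simp only: of_real_eq_0_iff)
    with Suc have "- (of_nat n + (\<mu> + 1) / 2) * kummer_fps \<mu> $ n \<noteq> 0"
      by (simp only: mult_eq_0_iff neg_equal_0_iff_equal simp_thms)
    then show ?case unfolding kummer_fps_nth_Suc[OF refl, symmetric] by auto
  qed
  moreover have "coeff q (j + l) = kummer_fps \<mu> $ j"
    by (simp add: q_def coeff_sum M_coeff_top)
  ultimately have "coeff q (j + l) \<noteq> 0" by simp
  moreover have "r \<ge> real l" using r by simp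
  ultimately obtain c where "p = smult c q"
    using opP_poly_solution_unique[of l r p j q] p q unfolding \<mu> by blast
  then have "poly p (of_real x) = (c / K) * polyM \<mu> l j x" if "x > 0" for x :: real
    using M[OF that] K by simp
  then show "\<exists>c. \<forall>x::real>0. poly p (of_real x) = c * polyM \<mu> l j x" by blast
qed

end
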